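(* For a positive integer $k$, let $\mathcal{G}_{+,k}$ be the set of graphs $G$ with at most $2k$ vertices such that there exist a PSD forcing set $B$ of $G$ and a set of PSD forces $\mathcal{F}$ of $B$ with $\operatorname{pt}_+(G;B)=\operatorname{pt}_+(G;\mathcal{F})=1$ and $|\mathcal{F}^{(1)}|=k$. (1) If a graph $G$ contains a graph in $\mathcal{G}_{+,k}$ as an induced subgraph, then $|V(G)|-k\geq\operatorname{th}^*_{+}(G)$. (2) Suppose $G$ is a non-empty graph on $n$ vertices that does not contain a graph in $\mathcal{G}_{+,k}$ as an induced subgraph. If $1<k<(n/12)^{1/3}$, then $\operatorname{th}^*_{+}(G)=k_{+}(G,1)>|V(G)|-k$.
   Context: All graphs are simple, finite and undirected. PSD color change rule: given the current blue set $B\subseteq V(G)$, let $W_1,\dots,W_m$ be the vertex sets of the components of $G-B$; a blue vertex $v$ can force $w$ (turn it blue) if $w$ is the unique white neighbor of $v$ in $G[B\cup W_i]$ for some $i$. From an initial blue set $B$, applying valid forces until none is possible yields a final coloring; $B$ is a PSD forcing set if this is all of $V(G)$. The set of forces in a chronological list of forces so performed is a set of PSD forces of $B$. For such $\mathcal{F}$: $\mathcal{F}^{(0)}=B$; for $t>0$, with $\bigcup_{i<t}\mathcal{F}^{(i)}$ blue, $\mathcal{F}^{(t)}$ is the set of white $w$ for which there is a blue $b$ with $(b\rightarrow w)\in\mathcal{F}$ valid; $\mathcal{F}^{[t]}=\bigcup_{i\le t}\mathcal{F}^{(i)}$. $\operatorname{pt}_+(G;\mathcal{F})$ is the least $q$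 with $\mathcal{F}^{[q]}=V(G)$ ($\infty$ if none); $\operatorname{pt}_+(G;B)$ is its minimum over sets of PSD forces of $B$. The (no initial cost) PSD product throttling number is $\operatorname{th}^*_+(G)=\min\{|B|\cdot\operatorname{pt}_+(G;B): B\subsetneq V(G)\}$, and $k_+(G,p)$ is the minimum cardinality of a PSD forcing set $B$ of $G$ with $\operatorname{pt}_+(G;B)=p$. *)

theory Defs
  imports Complex_Main "HOL-Library.Extended_Nat" "Graph_Theory.Graph_Theory"
begin

text \<open>
  Finite simple undirected graphs are the symmetric digraphs satisfying the locale
  \<^locale>\<open>graph\<close> (finite, loop-free, without parallel arcs). In a symmetric digraph the
  strongly connected components are the connected components.
\<close>

definition psd_can_force :: "('a,'b) pre_digraph \<Rightarrow> 'a set \<Rightarrow> 'a \<Rightarrow> 'a \<Rightarrow> bool" where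
  "psd_can_force G B v w \<longleftrightarrow> v \<in> B \<and>
     (\<exists>W \<in> pre_digraph.sccs_verts (G \<restriction> (verts G - B)).
        {u. v \<rightarrow>\<^bsub>G \<restriction> (B \<union> W)\<^esub> u \<and> u \<notin> B} = {w})"

text \<open>Lists of successive valid forces; a pair \<open>(v, w)\<close> stands for the force of \<open>w\<close> by \<open>v\<close>.\<close>

primrec psd_force_seq :: "('a,'b) pre_digraph \<Rightarrow> 'a set \<Rightarrow> ('a \<times> 'a) list \<Rightarrow> bool" where
  "psd_force_seq G B [] \<longleftrightarrow> True"
| "psd_force_seq G B (f # fs) \<longleftrightarrow>
     psd_can_force G B (fst f) (snd f) \<and> psd_force_seq G (insert (snd f) B) fs"

text \<open>The list is continued until no further force is possible.\<close>

definition psd_chron_list :: "('a,'b) pre_digraph \<Rightarrow> 'a set \<Rightarrow> ('a \<times> 'a) list \<Rightarrow> bool" where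
  "psd_chron_list G B fs \<longleftrightarrow> B \<subseteq> verts G \<and> psd_force_seq G B fs \<and>
     \<not> (\<exists>v w. psd_can_force G (B \<union> snd ` set fs) v w)"

definition psd_set_of_forces :: "('a,'b) pre_digraph \<Rightarrow> 'a set \<Rightarrow> ('a \<times> 'a) set \<Rightarrow> bool" where
  "psd_set_of_forces G B F \<longleftrightarrow> (\<exists>fs. psd_chron_list G B fs \<and> F = set fs)"

definition psd_forcing_set :: "('a,'b) pre_digraph \<Rightarrow> 'a set \<Rightarrow> bool" where
  "psd_forcing_set G B \<longleftrightarrow> (\<exists>fs. psd_chron_list G B fs \<and> B \<union> snd ` set fs = verts G)"

definition psd_new :: "('a,'b) pre_digraph \<Rightarrow> ('a \<times> 'a) set \<Rightarrow> 'a set \<Rightarrow> 'a set" where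
  "psd_new G F U = {w \<in> verts G - U. \<exists>b \<in> U. (b, w) \<in> F \<and> psd_can_force G U b w}"

text \<open>
  \<open>psd_upto G B F t\<close> is the set of vertices that are blue after \<open>t\<close> time steps, and \<open>psd_at G B F t\<close>
  the set of vertices that turn blue in step \<open>t\<close>. The initial set \<open>B\<close> is an explicit argument since
  it cannot be recovered from the set of pairs \<open>F\<close>.
\<close>

primrec psd_upto :: "('a,'b) pre_digraph \<Rightarrow> 'a set \<Rightarrow> ('a \<times> 'a) set \<Rightarrow> nat \<Rightarrow> 'a set" where
  "psd_upto G B F 0 = B"
| "psd_upto G B F (Suc t) = psd_upto G B F t \<union> psd_new G F (psd_upto G B F t)"

primrec psd_at :: "('a,'b) pre_digraph \<Rightarrow> 'a set \<Rightarrow> ('a \<times> 'a) set \<Rightarrow> nat \<Rightarrow> 'a set" where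
  "psd_at G B F 0 = B"
| "psd_at G B F (Suc t) = psd_new G F (psd_upto G B F t)"

lemma psd_upto_eq: "psd_upto G B F t = (\<Union>i\<le>t. psd_at G B F i)"
  by (induction t) (auto simp: atMost_Suc)

text \<open>In the following, the infimum of the empty set of extended naturals is \<open>\<infinity>\<close>.\<close>

definition pt_forces :: "('a,'b) pre_digraph \<Rightarrow> 'a set \<Rightarrow> ('a \<times> 'a) set \<Rightarrow> enat" where
  "pt_forces G B F = Inf {enat q | q. psd_upto G B F q = verts G}"

definition pt_psd :: "('a,'b) pre_digraph \<Rightarrow> 'a set \<Rightarrow> enat" where
  "pt_psd G B = Inf {pt_forces G B F | F. psd_set_of_forces G B F}"

text \<open>
  The cost of a set that is not a PSD forcing set is infinite, also when the set is empty. This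
  case has to be separated because \<open>0 * \<infinity> = 0\<close> in \<^typ>\<open>enat\<close>.
\<close>

definition psd_product_cost :: "('a,'b) pre_digraph \<Rightarrow> 'a set \<Rightarrow> enat" where
  "psd_product_cost G B =
     (if pt_psd G B = \<infinity> then \<infinity> else enat (card B) * pt_psd G B)"

definition th_psd_star :: "('a,'b) pre_digraph \<Rightarrow> enat" where
  "th_psd_star G = Inf {psd_product_cost G B | B. B \<subset> verts G}"

definition k_psd :: "('a,'b) pre_digraph \<Rightarrow> nat \<Rightarrow> enat" where
  "k_psd G p = Inf {enat (card B) | B. psd_forcing_set G B \<and> pt_psd G B = enat p}"

definition psd_class :: "nat \<Rightarrow> ('a,'b) pre_digraph set" where
  "psd_class k = {H. graph H \<and> card (verts H) \<le> 2 * k \<and>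
     (\<exists>B F. psd_forcing_set H B \<and> psd_set_of_forces H B F \<and>
        pt_psd H B = 1 \<and> pt_forces H B F = 1 \<and> card (psd_at H B F 1) = k)}"

text \<open>
  The class is closed under isomorphism, so containing a member up to isomorphism amounts to
  having an induced subgraph that is a member.
\<close>

definition contains_psd_class :: "nat \<Rightarrow> ('a,'b) pre_digraph \<Rightarrow> bool" where
  "contains_psd_class k G \<longleftrightarrow> (\<exists>H \<in> psd_class k. induced_subgraph H G)"

end

theory Submission
  imports Defs
begin

text \<open>
  A set \<open>W\<close> of \<open>k\<close> vertices that are forced simultaneously by the vertices outside, together with one
  forcer for each, induces a member of the class. Hence, if the class is avoided, every time step
  forces fewer than \<open>k\<close> vertices. A propagation in at least two steps of cost below \<open>n - 1\<close> then has
  \<open>|B| < k\<close>, since \<open>n > 12 k\<^sup>3\<close>. Along forces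
  the number of blue vertices adjacent to a white component never exceeds \<open>|B|\<close>, so the
  forced vertices can be coloured greedily with \<open>|B| + 1\<close> colours, and a large colour
  class is an independent set of \<open>k\<close> non-isolated vertices, which again yields a member of the class.
\<close>

section \<open>Forces in terms of white walks\<close>

text \<open>For white vertices, the reflexive-transitive closure of this relation means lying in the
  same component of \<open>G - B\<close>. Walks replace strongly connected components because they
  suit induction and comparison of blue sets.\<close>

definition white_arcs :: "('a,'b) pre_digraph \<Rightarrow> 'a set \<Rightarrow> ('a \<times> 'a) set" where
  "white_arcs G B = {(x, y). x \<rightarrow>\<^bsub>G\<^esub> y \<and> x \<notin> B \<and> y \<notin> B}"

lemma dominates_induce_iff: "u \<rightarrow>\<^bsub>G \<restriction> S\<^esub> v \<longleftrightarrow> u \<in> S \<and> v \<in> S \<and> u \<rightarrow>\<^bsub>G\<^esub> v"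
  by (auto simp: arcs_ends_conv)

lemma graph_induced_subgraph:
  assumes "graph G" and "induced_subgraph H G"
  shows "graph H"
proof -
  interpret graph G by fact
  interpret H: digraph H using assms(2) by (rule digraphI_induced)
  show ?thesis
    using induced_graph_imp_symmetric[OF sym_arcs assms(2)] by (rule H.graphI)
qed

lemma white_arcs_rtrancl_notin:
  "(w, u) \<in> (white_arcs G B)\<^sup>* \<Longrightarrow> w \<notin> B \<Longrightarrow> u \<notin> B"
  by (induction rule: rtrancl_induct) (auto simp: white_arcs_def)

lemma white_arcs_rtrancl_sym:
  assumes "graph G" and "(w, u) \<in> (white_arcs G B)\<^sup>*"
  shows "(u, w) \<in> (white_arcs G B)\<^sup>*"
proof -
  interpret graph G by fact
  have "sym (white_arcs G B)"
    by (auto simp: sym_def white_arcs_def graph_symmetric)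
  then show ?thesis using assms(2) by (meson sym_rtrancl symD)
qed

lemma white_arcs_antimono: "B \<subseteq> C \<Longrightarrow> white_arcs G C \<subseteq> white_arcs G B"
  by (auto simp: white_arcs_def)

text \<open>Only the component containing \<open>w\<close> can witness the force. By symmetry of
  \<open>G\<close> it is the set reached from \<open>w\<close> by white walks, so the quantifier
  over components disappears.\<close>

lemma psd_can_force_iff:
  assumes "graph G"
  shows "psd_can_force G B v w \<longleftrightarrow>
    v \<in> B \<and> w \<notin> B \<and> v \<rightarrow>\<^bsub>G\<^esub> w \<and> (\<forall>u. (w, u) \<in> (white_arcs G B)\<^sup>* \<and> v \<rightarrow>\<^bsub>G\<^esub> u \<longrightarrow> u = w)"
proof -
  interpret G: graph G by fact
  let ?H = "G \<restriction> (verts G - B)"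
  interpret H: sym_digraph ?H
    by (rule G.induced_graph_imp_graph) (auto intro: G.induced_induce)
  have ends: "arcs_ends ?H = white_arcs G B"
    using G.adj_in_verts by (auto simp: dominates_induce_iff white_arcs_def)
  have reach: "x \<rightarrow>\<^sup>*\<^bsub>?H\<^esub> y \<longleftrightarrow> (x, y) \<in> (white_arcs G B)\<^sup>*" if "x \<in> verts G - B" for x y
    using H.reachable_conv'[of x y] that ends by simp
  have component: "S = {u. (w, u) \<in> (white_arcs G B)\<^sup>*}" if "S \<in> H.sccs_verts" "w \<in> S" for S w
  proof -
    have "w \<in> verts ?H" using H.sccs_verts_subsets that by blast
    then have "{u. (w, u) \<in> (white_arcs G B)\<^sup>*} = {u. w \<rightarrow>\<^sup>*\<^bsub>?H\<^esub> u}" using reach by auto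
    also have "\<dots> = S" using that H.symmetric_reachable' by (auto simp: H.sccs_verts_def)
    finally show ?thesis ..
  qed
  have unfold_force: "{u. v \<rightarrow>\<^bsub>G \<restriction> (B \<union> W)\<^esub> u \<and> u \<notin> B} = {u \<in> W. v \<rightarrow>\<^bsub>G\<^esub> u}"
    if "v \<in> B" "W \<in> H.sccs_verts" for W
    using that H.sccs_verts_subsets[of W] by (auto simp: dominates_induce_iff)
  show ?thesis
  proof
    assume "psd_can_force G B v w"
    then obtain W where W: "v \<in> B" "W \<in> H.sccs_verts" "{u \<in> W. v \<rightarrow>\<^bsub>G\<^esub> u} = {w}"
      unfolding psd_can_force_def using unfold_force by auto
    then have w: "w \<in> W" "v \<rightarrow>\<^bsub>G\<^esub> w" by auto
    moreover have "w \<notin> B" using H.sccs_verts_subsets[OF W(2)] w(1) by auto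
    moreover have "\<forall>u. (w, u) \<in> (white_arcs G B)\<^sup>* \<and> v \<rightarrow>\<^bsub>G\<^esub> u \<longrightarrow> u = w"
      using component[OF W(2) w(1)] W(3) by blast
    ultimately show "v \<in> B \<and> w \<notin> B \<and> v \<rightarrow>\<^bsub>G\<^esub> w \<and>
      (\<forall>u. (w, u) \<in> (white_arcs G B)\<^sup>* \<and> v \<rightarrow>\<^bsub>G\<^esub> u \<longrightarrow> u = w)" using W(1) by simp
  next
    assume force: "v \<in> B \<and> w \<notin> B \<and> v \<rightarrow>\<^bsub>G\<^esub> w \<and>
      (\<forall>u. (w, u) \<in> (white_arcs G B)\<^sup>* \<and> v \<rightarrow>\<^bsub>G\<^esub> u \<longrightarrow> u = w)"
    then have w: "w \<in> verts ?H" using G.adj_in_verts by auto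
    have W: "H.scc_of w \<in> H.sccs_verts" "w \<in> H.scc_of w"
      using w H.scc_of_in_sccs_verts H.in_scc_of_self by blast+
    have "{u \<in> H.scc_of w. v \<rightarrow>\<^bsub>G\<^esub> u} = {w}"
      using component[OF W] force W(2) by auto
    with W(1) force unfold_force show "psd_can_force G B v w"
      unfolding psd_can_force_def by blast
  qed
qed

text \<open>With fewer white arcs the white component of \<open>w\<close> can only shrink, so the
  unique white neighbour stays unique. This serves for enlarging the blue set, for passing to an
  induced subgraph, and for going back from it to the host graph.\<close>

lemma psd_can_force_transfer:
  assumes "graph G" and "graph H" and force: "psd_can_force G B v w"
    and "v \<in> C" and "w \<notin> C" and "v \<rightarrow>\<^bsub>H\<^esub> w"
    and white: "white_arcs H C \<subseteq> white_arcs G B"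
    and adj: "\<And>u. u \<notin> C \<Longrightarrow> v \<rightarrow>\<^bsub>H\<^esub> u \<Longrightarrow> v \<rightarrow>\<^bsub>G\<^esub> u"
  shows "psd_can_force H C v w"
  unfolding psd_can_force_iff[OF assms(2)]
proof (intro conjI allI impI)
  fix u assume u: "(w, u) \<in> (white_arcs H C)\<^sup>* \<and> v \<rightarrow>\<^bsub>H\<^esub> u"
  then have "u \<notin> C" using white_arcs_rtrancl_notin assms(5) by fast
  with u have "v \<rightarrow>\<^bsub>G\<^esub> u" using adj by blast
  moreover have "(w, u) \<in> (white_arcs G B)\<^sup>*" using u white rtrancl_mono by blast
  ultimately show "u = w" using force psd_can_force_iff[OF assms(1)] by metis
qed (use assms in auto)

lemma psd_can_force_mono:
  assumes "graph G" and "psd_can_force G B v w" and "B \<subseteq> C" and "w \<notin> C"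
  shows "psd_can_force G C v w"
  using assms(3,4) assms(2)[unfolded psd_can_force_iff[OF assms(1)]]
  by (intro psd_can_force_transfer[OF assms(1,1,2)] white_arcs_antimono) auto

section \<open>Sets of forces and propagation time\<close>

text \<open>Forces valid at the same moment do not spoil each other: performing one only enlarges
  the blue set, and distinctness keeps the remaining targets white.\<close>

lemma psd_force_seq_simultaneous:
  assumes "graph G" and "distinct ws" and "\<And>w. w \<in> set ws \<Longrightarrow> psd_can_force G B (f w) w"
  shows "psd_force_seq G B (map (\<lambda>w. (f w, w)) ws)"
  using assms(2,3)
proof (induction ws arbitrary: B)
  case (Cons a ws)
  have "psd_can_force G (insert a B) (f w) w" if "w \<in> set ws" for w
  proof (rule psd_can_force_mono[OF assms(1)])
    show force: "psd_can_force G B (f w) w" using that by (intro Cons.prems(2)) simp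
    have "w \<notin> B" using force by (simp add: psd_can_force_iff[OF assms(1)])
    moreover have "w \<noteq> a" using that Cons.prems(1) by auto
    ultimately show "w \<notin> insert a B" by simp
  qed blast
  with Cons show ?case by simp
qed simp

section \<open>Propagation times as attained infima\<close>

lemma pt_forces_le: "psd_upto G B F q = verts G \<Longrightarrow> pt_forces G B F \<le> enat q"
  unfolding pt_forces_def by (auto intro: Inf_lower)

lemma Inf_enat_mem:
  assumes "Inf A = enat q"
  shows "enat q \<in> A"
proof -
  have "A \<noteq> {}" using assms by (intro notI) (simp add: top_enat_def)
  then have "Inf A \<in> A" using wellorder_InfI by blast
  then show ?thesis using assms by simp
qed

lemma pt_forces_attained:
  assumes "pt_forces G B F = enat q"
  shows "psd_upto G B F q = verts G"
  using Inf_enat_mem[OF assms[unfolded pt_forces_def]] by simp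

lemma pt_psd_attained:
  assumes "pt_psd G B = enat q"
  obtains F where "psd_set_of_forces G B F" "pt_forces G B F = enat q"
  using Inf_enat_mem[OF assms[unfolded pt_psd_def]] by auto

lemma pt_forces_pos:
  assumes "B \<noteq> verts G"
  shows "1 \<le> pt_forces G B F"
  unfolding pt_forces_def
proof (rule Inf_greatest)
  fix x assume "x \<in> {enat q | q. psd_upto G B F q = verts G}"
  then obtain q where q: "x = enat q" "psd_upto G B F q = verts G" by auto
  with assms have "q \<noteq> 0" by (intro notI) simp
  with q show "1 \<le> x" by (simp add: one_enat_def)
qed

lemma pt_psd_pos: "B \<noteq> verts G \<Longrightarrow> 1 \<le> pt_psd G B"
  unfolding pt_psd_def by (rule Inf_greatest) (auto intro: pt_forces_pos)

lemma psd_upto_forced: "psd_upto G B F t \<subseteq> B \<union> snd ` F"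
  by (induction t) (force simp: psd_new_def)+

lemma psd_force_seq_verts:
  assumes "graph G" and "psd_force_seq G B fs"
  shows "snd ` set fs \<subseteq> verts G - B"
  using assms(2)
proof (induction fs arbitrary: B)
  case (Cons f fs)
  interpret graph G by fact
  have "snd f \<in> verts G - B"
    using Cons.prems adj_in_verts(2)[of "fst f" "snd f"] by (auto simp: psd_can_force_iff[OF assms(1)])
  moreover have "snd ` set fs \<subseteq> verts G - insert (snd f) B" using Cons by simp
  ultimately show ?case by auto
qed simp

text \<open>The throttling number ranges over all proper subsets, forcing or not. A finite
  propagation time recovers the forcing property, since only \<open>B\<close> and targets of
  \<open>F\<close> ever turn blue.\<close>

lemma psd_forcing_set_of_pt:
  assumes "graph G" and "pt_psd G B = enat q"
  shows "psd_forcing_set G B"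
proof -
  obtain F where F: "psd_set_of_forces G B F" "pt_forces G B F = enat q"
    using assms(2) by (rule pt_psd_attained)
  obtain fs where fs: "psd_chron_list G B fs" "F = set fs"
    using F(1) by (auto simp: psd_set_of_forces_def)
  have "verts G \<subseteq> B \<union> snd ` set fs"
    using pt_forces_attained[OF F(2)] psd_upto_forced[of G B F q] fs(2) by simp
  moreover have "B \<union> snd ` set fs \<subseteq> verts G"
    using fs psd_force_seq_verts[OF assms(1)] by (auto simp: psd_chron_list_def)
  ultimately show ?thesis using fs(1) by (auto simp: psd_forcing_set_def)
qed

text \<open>The common source of one-step witnesses: members of the class, the cheap set for the
  first claim, and the set bounding \<open>k_psd G 1\<close>.\<close>

lemma one_step_propagation:
  assumes "graph G" and "W \<subseteq> verts G" and "W \<noteq> {}"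
    and force: "\<And>w. w \<in> W \<Longrightarrow> psd_can_force G (verts G - W) (f w) w"
  defines "F \<equiv> (\<lambda>w. (f w, w)) ` W"
  shows "psd_set_of_forces G (verts G - W) F" and "psd_forcing_set G (verts G - W)"
    and "pt_forces G (verts G - W) F = 1" and "pt_psd G (verts G - W) = 1"
    and "psd_at G (verts G - W) F 1 = W"
proof -
  interpret graph G by fact
  let ?B = "verts G - W"
  obtain ws where ws: "set ws = W" "distinct ws"
    using finite_distinct_list finite_subset[OF assms(2)] by auto
  let ?fs = "map (\<lambda>w. (f w, w)) ws"
  have fs: "set ?fs = F" "?B \<union> snd ` set ?fs = verts G"
    using ws assms(2) by (force simp: F_def)+
  have seq: "psd_force_seq G ?B ?fs"
    using psd_force_seq_simultaneous[OF assms(1) ws(2)] ws(1) force by blast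
  \<comment> \<open>A chronological list must be exhausted. Once all vertices are blue, a further
    target would be the head of an arc outside the vertex set.\<close>
  have "\<not> psd_can_force G (verts G) v w" for v w
    using adj_in_verts(2)[of v w] by (auto simp: psd_can_force_iff[OF assms(1)])
  with seq fs(2) have chron: "psd_chron_list G ?B ?fs" by (auto simp: psd_chron_list_def)
  then show set_forces: "psd_set_of_forces G ?B F" using fs(1) by (auto simp: psd_set_of_forces_def)
  show "psd_forcing_set G ?B" using chron fs(2) unfolding psd_forcing_set_def by blast
  have new: "psd_new G F ?B = W"
  proof
    show "W \<subseteq> psd_new G F ?B"
    proof
      fix w assume w: "w \<in> W"
      then have "f w \<in> ?B" using force[OF w] psd_can_force_iff[OF assms(1)] by simp
      with w assms(2) force[OF w] show "w \<in> psd_new G F ?B"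
        unfolding psd_new_def F_def by blast
    qed
  qed (auto simp: psd_new_def)
  then show "psd_at G ?B F 1 = W" by simp
  have neq: "?B \<noteq> verts G" using assms(2,3) by auto
  have "psd_upto G ?B F 1 = verts G" using new assms(2) by auto
  then have "pt_forces G ?B F \<le> 1" using pt_forces_le by (fastforce simp: one_enat_def)
  with pt_forces_pos[OF neq] show one: "pt_forces G ?B F = 1" by (rule antisym[rotated])
  then have "pt_psd G ?B \<le> 1"
    unfolding pt_psd_def using set_forces by (metis (mono_tags, lifting) Inf_lower mem_Collect_eq)
  with pt_psd_pos[OF neq] show "pt_psd G ?B = 1" by (rule antisym[rotated])
qed

section \<open>The class of forbidden subgraphs\<close>

text \<open>Only \<open>W\<close> and one forcer for each element are kept. Targets are white and
  forcers blue, so deleting the other vertices adds no white arc and every force survives.\<close>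

lemma contains_psd_classI:
  assumes "graph G" and force: "\<And>w. w \<in> W \<Longrightarrow> psd_can_force G B (f w) w"
    and "card W = k" and "k > 0"
  shows "contains_psd_class k G"
proof -
  interpret graph G by fact
  let ?V = "W \<union> f ` W"
  let ?H = "G \<restriction> ?V"
  have fin: "finite W" using assms(3,4) by (metis card.infinite less_irrefl)
  have props: "f w \<in> B" "w \<notin> B" "f w \<rightarrow>\<^bsub>G\<^esub> w" if "w \<in> W" for w
    using force[OF that] psd_can_force_iff[OF assms(1)] by auto
  then have "?V \<subseteq> verts G" using adj_in_verts by blast
  then have ind: "induced_subgraph ?H G" by (rule induced_induce)
  then have H: "graph ?H" by (rule graph_induced_subgraph[OF assms(1)])
  have diff: "verts ?H - W = f ` W" using props by auto
  have "psd_can_force ?H (verts ?H - W) (f w) w" if "w \<in> W" for w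
    unfolding diff
    using that props[OF that] props(1,2)
    by (intro psd_can_force_transfer[OF assms(1) H force[OF that]])
      (auto simp: dominates_induce_iff white_arcs_def)
  moreover have "W \<noteq> {}" using assms(3,4) by auto
  ultimately have step: "psd_set_of_forces ?H (f ` W) ((\<lambda>w. (f w, w)) ` W)"
    "psd_forcing_set ?H (f ` W)" "pt_forces ?H (f ` W) ((\<lambda>w. (f w, w)) ` W) = 1"
    "pt_psd ?H (f ` W) = 1" "psd_at ?H (f ` W) ((\<lambda>w. (f w, w)) ` W) 1 = W"
    using one_step_propagation[OF H, of W f] unfolding diff by auto
  have "card ?V \<le> 2 * k"
    using card_Un_le[of W "f ` W"] card_image_le[OF fin, of f] assms(3) by linarith
  then have "?H \<in> psd_class k"
    unfolding psd_class_def using H step assms(3) by fastforce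
  with ind show ?thesis by (auto simp: contains_psd_class_def)
qed

text \<open>Let \<open>W\<close> be the vertices that the member forces in its single step, and make
  everything else in \<open>G\<close> blue. White arcs then run inside \<open>W\<close> just as in
  the subgraph, so the same forces are valid in \<open>G\<close>.\<close>

lemma contains_psd_class_obtain:
  assumes "graph G" and "contains_psd_class k G"
  obtains W f where "W \<subseteq> verts G" "card W = k"
    "\<And>w. w \<in> W \<Longrightarrow> psd_can_force G (verts G - W) (f w) w"
proof -
  obtain H where ind: "induced_subgraph H G" and "H \<in> psd_class k"
    using assms(2) by (auto simp: contains_psd_class_def)
  then obtain B F where H: "graph H" and F: "pt_forces H B F = 1"
      and card: "card (psd_at H B F 1) = k"
    unfolding psd_class_def by blast
  define W where "W = psd_new H F B"
  have "psd_upto H B F 1 = verts H"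
    using F by (intro pt_forces_attained) (simp add: one_enat_def)
  then have verts: "B \<union> W = verts H" by (simp add: W_def)
  have disj: "B \<inter> W = {}" by (auto simp: W_def psd_new_def)
  have sub: "verts H \<subseteq> verts G" using ind by (auto simp: induced_subgraph_def subgraph_def)
  have adj: "u \<rightarrow>\<^bsub>H\<^esub> v \<longleftrightarrow> u \<rightarrow>\<^bsub>G\<^esub> v" if "u \<in> verts H" "v \<in> verts H" for u v
    using ind that by (force simp: induced_subgraph_def subgraph_def compatible_def arcs_ends_conv)
  have "\<forall>w\<in>W. \<exists>b. psd_can_force H B b w" by (auto simp: W_def psd_new_def)
  then obtain f where f: "\<And>w. w \<in> W \<Longrightarrow> psd_can_force H B (f w) w" by metis
  show thesis
  proof
    show "W \<subseteq> verts G" using verts sub by blast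
    show "card W = k" using card by (simp add: W_def)
    fix w assume w: "w \<in> W"
    interpret G: graph G by fact
    have fw: "f w \<in> B" "f w \<rightarrow>\<^bsub>H\<^esub> w" using f[OF w] psd_can_force_iff[OF H] by auto
    show "psd_can_force G (verts G - W) (f w) w"
    proof (rule psd_can_force_transfer[OF H assms(1) f[OF w]])
      \<comment> \<open>Points outside the graph also count as not blue, but endpoints of arcs are
        vertices and hence lie in \<open>W\<close>.\<close>
      show "white_arcs G (verts G - W) \<subseteq> white_arcs H B"
      proof (clarsimp simp: white_arcs_def)
        fix a b assume ab: "a \<rightarrow>\<^bsub>G\<^esub> b" "a \<in> verts G \<longrightarrow> a \<in> W" "b \<in> verts G \<longrightarrow> b \<in> W"
        then have "a \<in> W" "b \<in> W" using G.adj_in_verts by blast+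
        then show "a \<rightarrow>\<^bsub>H\<^esub> b \<and> a \<notin> B \<and> b \<notin> B" using ab(1) verts disj adj by blast
      qed
      show "f w \<rightarrow>\<^bsub>H\<^esub> u" if "u \<notin> verts G - W" "f w \<rightarrow>\<^bsub>G\<^esub> u" for u
        using that verts fw adj G.adj_in_verts by blast
    qed (use w fw verts disj sub adj[of "f w" w] in auto)
  qed
qed

text \<open>Any \<open>k\<close> vertices turning blue in one step would, with their forcers, induce
  a member of the class.\<close>

lemma card_psd_new_less:
  assumes "graph G" and "k > 0" and "\<not> contains_psd_class k G"
  shows "card (psd_new G F U) < k"
proof (rule ccontr)
  assume "\<not> ?thesis"
  then obtain W where W: "W \<subseteq> psd_new G F U" "card W = k"
    by (meson not_less obtain_subset_with_card_n)
  then have "\<forall>w\<in>W. \<exists>b. psd_can_force G U b w" by (auto simp: psd_new_def)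
  then obtain f where "\<And>w. w \<in> W \<Longrightarrow> psd_can_force G U (f w) w" by metis
  then show False using contains_psd_classI[OF assms(1) _ W(2) assms(2)] assms(3) by blast
qed

lemma card_psd_upto_le:
  assumes "graph G" and "k > 0" and "\<not> contains_psd_class k G"
  shows "card (psd_upto G B F t) \<le> card B + t * (k - 1)"
proof (induction t)
  case (Suc t)
  have "card (psd_upto G B F (Suc t)) \<le> card (psd_upto G B F t) + card (psd_new G F (psd_upto G B F t))"
    by (simp add: card_Un_le)
  also have "\<dots> \<le> card B + t * (k - 1) + (k - 1)"
    using Suc card_psd_new_less[OF assms, of F "psd_upto G B F t"] by linarith
  finally show ?case by simp
qed simp

section \<open>Colouring the forced vertices\<close>

text \<open>These are the blue neighbours of the component of \<open>G - B\<close> containing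
  \<open>w\<close>. A bound on their number, kept through the process, limits the blue neighbours of
  each vertex at the moment it is forced.\<close>

definition white_boundary :: "('a,'b) pre_digraph \<Rightarrow> 'a set \<Rightarrow> 'a \<Rightarrow> 'a set" where
  "white_boundary G B w = {x \<in> B. \<exists>u. (w, u) \<in> (white_arcs G B)\<^sup>* \<and> u \<rightarrow>\<^bsub>G\<^esub> x}"

text \<open>
  In the boundary of the component of \<open>w\<close>, the vertex \<open>w\<close> replaces its forcer, whose only
  neighbour in that component is \<open>w\<close>.
\<close>

lemma card_white_boundary_step:
  assumes "graph G" and "B \<subseteq> verts G" and force: "psd_can_force G B v w"
    and bound: "\<And>x. x \<notin> B \<Longrightarrow> card (white_boundary G B x) \<le> b" and "x \<notin> insert w B"
  shows "card (white_boundary G (insert w B) x) \<le> b"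
proof -
  interpret graph G by fact
  have fin: "finite (white_boundary G B y)" for y
    using finite_subset[OF assms(2)] by (auto simp: white_boundary_def)
  have f: "v \<in> B" "w \<notin> B" "v \<rightarrow>\<^bsub>G\<^esub> w" "\<And>u. (w, u) \<in> (white_arcs G B)\<^sup>* \<Longrightarrow> v \<rightarrow>\<^bsub>G\<^esub> u \<Longrightarrow> u = w"
    using force psd_can_force_iff[OF assms(1)] by auto
  have old: "(x, u) \<in> (white_arcs G B)\<^sup>*" "u \<noteq> w" "u \<notin> B"
    if "(x, u) \<in> (white_arcs G (insert w B))\<^sup>*" for u
    using that white_arcs_rtrancl_notin[OF that assms(5)] rtrancl_mono[OF white_arcs_antimono[of B "insert w B" G]]
    by auto
  show ?thesis
  \<comment> \<open>Either \<open>x\<close> lay in the component of \<open>w\<close> before the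
    force, or its component is untouched by it.\<close>
  proof (cases "(x, w) \<in> (white_arcs G B)\<^sup>*")
    case True
    then have wx: "(w, x) \<in> (white_arcs G B)\<^sup>*" by (rule white_arcs_rtrancl_sym[OF assms(1)])
    have "y \<in> insert w (white_boundary G B w - {v})" if y_boundary: "y \<in> white_boundary G (insert w B) x" for y
    proof -
      obtain u where u: "(x, u) \<in> (white_arcs G (insert w B))\<^sup>*" "u \<rightarrow>\<^bsub>G\<^esub> y" and y: "y \<in> insert w B"
        using y_boundary unfolding white_boundary_def by blast
      have wu: "(w, u) \<in> (white_arcs G B)\<^sup>*" using wx old(1)[OF u(1)] by (rule rtrancl_trans)
      \<comment> \<open>A vertex of this component adjacent to the forcer must be \<open>w\<close>,
        but \<open>u\<close> is still white after \<open>w\<close> turned blue.\<close>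
      have "y \<noteq> v" using f(4)[OF wu] old(2)[OF u(1)] u(2) graph_symmetric by blast
      then show ?thesis using wu u(2) y by (auto simp: white_boundary_def)
    qed
    then have "card (white_boundary G (insert w B) x) \<le> card (insert w (white_boundary G B w - {v}))"
      using fin by (intro card_mono) auto
    also have "\<dots> \<le> Suc (card (white_boundary G B w - {v}))"
      using fin by (intro card_insert_le_m1) auto
    \<comment> \<open>The forcer was in the old boundary, so its removal pays for the insertion of
      \<open>w\<close>.\<close>
    also have "\<dots> = card (white_boundary G B w)"
      using fin f(1,3) graph_symmetric by (intro card_Suc_Diff1) (auto simp: white_boundary_def)
    finally show ?thesis using bound[OF f(2)] by simp
  next
    case False
    have "y \<in> white_boundary G B x" if y_boundary: "y \<in> white_boundary G (insert w B) x" for y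
    proof -
      obtain u where u: "(x, u) \<in> (white_arcs G (insert w B))\<^sup>*" "u \<rightarrow>\<^bsub>G\<^esub> y" and y: "y \<in> insert w B"
        using y_boundary unfolding white_boundary_def by blast
      have "y \<noteq> w"
      proof
        assume "y = w"
        then have "(u, w) \<in> white_arcs G B" using u(2) old(3)[OF u(1)] f(2) by (simp add: white_arcs_def)
        then show False using old(1)[OF u(1)] False by (meson rtrancl.rtrancl_into_rtrancl)
      qed
      then show ?thesis using old(1)[OF u(1)] u(2) y by (auto simp: white_boundary_def)
    qed
    then have "card (white_boundary G (insert w B) x) \<le> card (white_boundary G B x)"
      using fin by (intro card_mono) auto
    then show ?thesis using bound[of x] assms(5) by auto
  qed
qed

text \<open>Greedy colouring in the order of forcing. When \<open>w\<close> is forced, its coloured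
  neighbours lie in its white boundary, so one of the colours \<open>0\<close> to \<open>b\<close>
  is free. \<open>D\<close> holds the vertices coloured so far; it is kept apart from
  \<open>B\<close> because the initial blue vertices receive no colour.\<close>

lemma psd_force_seq_colouring:
  fixes c :: "'a \<Rightarrow> nat"
  assumes "graph G" and "psd_force_seq G B fs" and "B \<subseteq> verts G"
    and "\<And>x. x \<notin> B \<Longrightarrow> card (white_boundary G B x) \<le> b"
    and "D \<subseteq> B" and "\<And>x. x \<in> D \<Longrightarrow> c x \<le> b"
    and "\<And>x y. x \<in> D \<Longrightarrow> y \<in> D \<Longrightarrow> x \<rightarrow>\<^bsub>G\<^esub> y \<Longrightarrow> c x \<noteq> c y"
  shows "\<exists>c'. (\<forall>x \<in> D \<union> snd ` set fs. c' x \<le> b) \<and>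
    (\<forall>x \<in> D \<union> snd ` set fs. \<forall>y \<in> D \<union> snd ` set fs. x \<rightarrow>\<^bsub>G\<^esub> y \<longrightarrow> c' x \<noteq> c' y)"
  using assms(2-7)
proof (induction fs arbitrary: B D c)
  case Nil
  then show ?case by (intro exI[of _ c]) auto
next
  case (Cons a fs)
  interpret graph G by fact
  obtain v w where a: "a = (v, w)" by fastforce
  have force: "psd_can_force G B v w" and seq: "psd_force_seq G (insert w B) fs"
    using Cons.prems(1) a by auto
  have w: "w \<notin> B" "w \<in> verts G"
    using force adj_in_verts(2)[of v w] by (auto simp: psd_can_force_iff[OF assms(1)])
  let ?N = "{x \<in> D. w \<rightarrow>\<^bsub>G\<^esub> x}"
  have fin: "finite B" using Cons.prems(2) by (rule finite_subset) simp
  then have finN: "finite ?N" using finite_subset[OF Cons.prems(4)] by simp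
  have "card (c ` ?N) \<le> card ?N" using finN by (rule card_image_le)
  also have "\<dots> \<le> card (white_boundary G B w)"
    using Cons.prems(4) fin by (intro card_mono) (auto simp: white_boundary_def)
  also have "\<dots> < card {..b}" using Cons.prems(3)[OF w(1)] by simp
  finally have "\<not> {..b} \<subseteq> c ` ?N"
    using card_mono[of "c ` ?N" "{..b}"] finN by auto
  then obtain i where i: "i \<le> b" "i \<notin> c ` ?N" by auto
  let ?c = "c(w := i)"
  have "\<exists>c'. (\<forall>x \<in> insert w D \<union> snd ` set fs. c' x \<le> b) \<and>
    (\<forall>x \<in> insert w D \<union> snd ` set fs. \<forall>y \<in> insert w D \<union> snd ` set fs. x \<rightarrow>\<^bsub>G\<^esub> y \<longrightarrow> c' x \<noteq> c' y)"
  proof (rule Cons.IH[OF seq])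
    show "insert w B \<subseteq> verts G" using w Cons.prems(2) by auto
    show "card (white_boundary G (insert w B) x) \<le> b" if "x \<notin> insert w B" for x
      using card_white_boundary_step[OF assms(1) Cons.prems(2) force Cons.prems(3) that] by blast
    show "insert w D \<subseteq> insert w B" using Cons.prems(4) by auto
    show "?c x \<le> b" if "x \<in> insert w D" for x using that i Cons.prems(5) by auto
    show "?c x \<noteq> ?c y" if "x \<in> insert w D" "y \<in> insert w D" "x \<rightarrow>\<^bsub>G\<^esub> y" for x y
      using that i(2) Cons.prems(6)[of x y] graph_symmetric[of x y] adj_not_same
      by (auto simp: image_iff)
  qed
  then show ?case using a by simp
qed

text \<open>Pigeonhole on the colour classes: every boundary initially lies in \<open>B\<close>, so
  \<open>card B + 1\<close> colours suffice for the forced vertices.\<close>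

lemma psd_force_seq_independent:
  assumes "graph G" and "psd_force_seq G B fs" and "B \<subseteq> verts G"
    and "(card B + 1) * m < card (snd ` set fs)"
  obtains I where "I \<subseteq> snd ` set fs" "card I = Suc m" "\<And>x y. x \<in> I \<Longrightarrow> y \<in> I \<Longrightarrow> \<not> x \<rightarrow>\<^bsub>G\<^esub> y"
proof -
  interpret graph G by fact
  let ?X = "snd ` set fs"
  have "card (white_boundary G B x) \<le> card B" for x
    using finite_subset[OF assms(3)] by (intro card_mono) (auto simp: white_boundary_def)
  \<comment> \<open>The colouring starts from the empty set \<open>D\<close>.\<close>
  then have "\<exists>c. (\<forall>x \<in> {} \<union> ?X. c x \<le> card B) \<and>
      (\<forall>x \<in> {} \<union> ?X. \<forall>y \<in> {} \<union> ?X. x \<rightarrow>\<^bsub>G\<^esub> y \<longrightarrow> c x \<noteq> c y)"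
    by (intro psd_force_seq_colouring[OF assms(1-3)]) auto
  then obtain c where "(\<forall>x \<in> ?X. c x \<le> card B) \<and> (\<forall>x \<in> ?X. \<forall>y \<in> ?X. x \<rightarrow>\<^bsub>G\<^esub> y \<longrightarrow> c x \<noteq> c y)"
    unfolding Un_empty_left by (rule exE)
  then have c: "\<And>x. x \<in> ?X \<Longrightarrow> c x \<le> card B"
      "\<And>x y. x \<in> ?X \<Longrightarrow> y \<in> ?X \<Longrightarrow> x \<rightarrow>\<^bsub>G\<^esub> y \<Longrightarrow> c x \<noteq> c y" by auto
  have "\<exists>i. m < card {x \<in> ?X. c x = i}"
  proof (rule ccontr)
    assume "\<not> ?thesis"
    then have small: "card {x \<in> ?X. c x = i} \<le> m" for i by (auto simp: not_less)
    have "?X = (\<Union>i\<le>card B. {x \<in> ?X. c x = i})" using c(1) by auto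
    then have "card ?X \<le> (\<Sum>i\<le>card B. card {x \<in> ?X. c x = i})"
      using card_UN_le[of "{..card B}" "\<lambda>i. {x \<in> ?X. c x = i}"] by simp
    also have "\<dots> \<le> (\<Sum>i\<le>card B. m)" using small by (rule sum_mono)
    finally show False using assms(4) by simp
  qed
  then obtain i I where I: "I \<subseteq> {x \<in> ?X. c x = i}" "card I = Suc m"
    by (meson Suc_leI obtain_subset_with_card_n)
  show thesis
  proof
    show "I \<subseteq> ?X" using I(1) by auto
    show "card I = Suc m" by fact
    show "\<not> x \<rightarrow>\<^bsub>G\<^esub> y" if "x \<in> I" "y \<in> I" for x y
      using c(2)[of x y] I(1) that by auto
  qed
qed

section \<open>Independent sets of non-isolated vertices\<close>

lemma psd_force_seq_forced_has_neighbour: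
  assumes "graph G" and "psd_force_seq G B fs" and "w \<in> snd ` set fs"
  shows "\<exists>v. v \<rightarrow>\<^bsub>G\<^esub> w"
  using assms(2,3)
proof (induction fs arbitrary: B)
  case (Cons f fs)
  then have "fst f \<rightarrow>\<^bsub>G\<^esub> snd f" by (simp add: psd_can_force_iff[OF assms(1)])
  then have "\<exists>v. v \<rightarrow>\<^bsub>G\<^esub> snd f" ..
  with Cons show ?case by auto
qed simp

text \<open>If exactly \<open>I\<close> is white, every white component is a single vertex, and any
  neighbour of it is blue by independence and can force it.\<close>

lemma independent_contains_psd_class:
  assumes "graph G" and "card I = k" and "k > 0"
    and indep: "\<And>x y. x \<in> I \<Longrightarrow> y \<in> I \<Longrightarrow> \<not> x \<rightarrow>\<^bsub>G\<^esub> y" and nbr: "\<And>w. w \<in> I \<Longrightarrow> \<exists>v. v \<rightarrow>\<^bsub>G\<^esub> w"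
  shows "contains_psd_class k G"
proof -
  interpret graph G by fact
  obtain f where f: "\<And>w. w \<in> I \<Longrightarrow> f w \<rightarrow>\<^bsub>G\<^esub> w" using nbr by metis
  have "white_arcs G (verts G - I) = {}"
    using indep adj_in_verts by (auto simp: white_arcs_def)
  then have "psd_can_force G (verts G - I) (f w) w" if "w \<in> I" for w
    using that f indep adj_in_verts(1)[OF f[OF that]] by (auto simp: psd_can_force_iff[OF assms(1)])
  then show ?thesis by (rule contains_psd_classI[OF assms(1) _ assms(2,3)])
qed

text \<open>In contrast to \<open>card_psd_upto_le\<close>, this bound does not involve the
  propagation time, so it also limits slow propagation from a small set.\<close>

lemma card_verts_le_of_forcing:
  assumes "graph G" and "k > 0" and "\<not> contains_psd_class k G" and "psd_forcing_set G B"
  shows "card (verts G) \<le> card B + (card B + 1) * (k - 1)"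
proof -
  obtain fs where fs: "psd_chron_list G B fs" "B \<union> snd ` set fs = verts G"
    using assms(4) by (auto simp: psd_forcing_set_def)
  then have seq: "psd_force_seq G B fs" "B \<subseteq> verts G" by (auto simp: psd_chron_list_def)
  have "card (snd ` set fs) \<le> (card B + 1) * (k - 1)"
  proof (rule ccontr)
    assume "\<not> ?thesis"
    then obtain I where I: "I \<subseteq> snd ` set fs" "card I = Suc (k - 1)"
        "\<And>x y. x \<in> I \<Longrightarrow> y \<in> I \<Longrightarrow> \<not> x \<rightarrow>\<^bsub>G\<^esub> y"
      using psd_force_seq_independent[OF assms(1) seq, of "k - 1"] by (metis not_less)
    have "contains_psd_class k G"
    proof (rule independent_contains_psd_class[OF assms(1) _ assms(2) I(3)])
      show "card I = k" using I(2) assms(2) by simp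
      show "\<exists>v. v \<rightarrow>\<^bsub>G\<^esub> w" if "w \<in> I" for w
        using psd_force_seq_forced_has_neighbour[OF assms(1) seq(1)] I(1) that by blast
    qed
    then show False using assms(3) by blast
  qed
  then show ?thesis using fs(2) card_Un_le[of B "snd ` set fs"] by simp
qed

section \<open>Throttling\<close>

lemma th_psd_star_le:
  assumes "graph G" and "k > 0" and "contains_psd_class k G"
  shows "th_psd_star G \<le> enat (card (verts G) - k)"
proof -
  interpret graph G by fact
  obtain W f where W: "W \<subseteq> verts G" "card W = k"
      "\<And>w. w \<in> W \<Longrightarrow> psd_can_force G (verts G - W) (f w) w"
    using contains_psd_class_obtain[OF assms(1,3)] by blast
  have ne: "W \<noteq> {}" using W(2) assms(2) by auto
  have "pt_psd G (verts G - W) = 1" by (rule one_step_propagation(4)[OF assms(1) W(1) ne W(3)])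
  then have "psd_product_cost G (verts G - W) = enat (card (verts G) - k)"
    using W(1,2) finite_subset[OF W(1)] by (simp add: psd_product_cost_def card_Diff_subset one_enat_def)
  moreover have "verts G - W \<subset> verts G" using W(1) ne by auto
  ultimately show ?thesis
    unfolding th_psd_star_def by (metis (mono_tags, lifting) Inf_lower mem_Collect_eq)
qed

text \<open>One end of a single edge forces the other when all remaining vertices are blue. The
  resulting value is what slower sets have to beat.\<close>

lemma k_psd_one_le:
  assumes "graph G" and "arcs G \<noteq> {}"
  shows "k_psd G 1 \<le> enat (card (verts G) - 1)"
proof -
  obtain e where "e \<in> arcs G" using assms(2) by blast
  interpret graph G by fact
  define v w where "v = tail G e" and "w = head G e"
  have vw: "v \<rightarrow>\<^bsub>G\<^esub> w" using \<open>e \<in> arcs G\<close> by (simp add: v_def w_def arcs_ends_conv)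
  then have w: "{w} \<subseteq> verts G" "v \<in> verts G" "v \<noteq> w"
    using adj_in_verts[OF vw] adj_not_same by auto
  have "psd_can_force G (verts G - {w}) v w"
    unfolding psd_can_force_iff[OF assms(1)]
    using vw w white_arcs_rtrancl_notin[of w _ G "verts G - {w}"] adj_in_verts(2)[of v] by fastforce
  then have "psd_forcing_set G (verts G - {w})" "pt_psd G (verts G - {w}) = 1"
    using one_step_propagation(2,4)[OF assms(1) w(1), of "\<lambda>_. v"] by auto
  moreover have "card (verts G - {w}) = card (verts G) - 1" using w by simp
  ultimately show ?thesis unfolding k_psd_def one_enat_def by (intro Inf_lower) force
qed

lemma k_psd_one_greater:
  assumes "graph G" and "k > 0" and "\<not> contains_psd_class k G" and "k \<le> card (verts G)"
  shows "k_psd G 1 > enat (card (verts G) - k)"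
proof -
  \<comment> \<open>The strict inequality is restated as a lower bound one larger, so that it passes
    to the infimum. Truncated subtraction is harmless since \<open>k\<close> is at most the order of
    \<open>G\<close>.\<close>
  have "enat (card (verts G) - k + 1) \<le> k_psd G 1"
    unfolding k_psd_def
  proof (rule Inf_greatest)
    fix x assume "x \<in> {enat (card B) | B. psd_forcing_set G B \<and> pt_psd G B = enat 1}"
    then obtain B where B: "x = enat (card B)" "pt_psd G B = enat 1" by auto
    obtain F where "pt_forces G B F = enat 1" using B(2) by (rule pt_psd_attained)
    then have "psd_upto G B F 1 = verts G" by (rule pt_forces_attained)
    then have "card (verts G) \<le> card B + (k - 1)"
      using card_psd_upto_le[OF assms(1-3), of B F 1] by simp
    then show "enat (card (verts G) - k + 1) \<le> x" using B(1) assms(2,4) by simp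
  qed
  then show ?thesis by (meson enat_ord_simps(2) less_add_one less_le_trans)
qed

text \<open>Assuming a cost of at most \<open>n - 2\<close>, both ranges of \<open>b\<close> force
  \<open>n\<close> to be at most of order \<open>k * k\<close>, against
  \<open>12 * k ^ 3 < n\<close>. The fifth assumption settles \<open>b < k\<close>, the fourth
  settles the rest.\<close>

lemma slow_cost_arith:
  fixes n k b p :: nat
  assumes "12 * k ^ 3 < n" and "1 < k" and "2 \<le> p"
    and "n \<le> b + p * (k - 1)" and "n \<le> b + (b + 1) * (k - 1)"
  shows "n - 1 \<le> b * p"
proof (rule ccontr)
  assume "\<not> ?thesis"
  then have bp: "b * p + 2 \<le> n" by simp
  have cube: "k * k + k * k + k * k + k * k \<le> 12 * k ^ 3"
  proof -
    have "k ^ 2 \<le> k ^ 3" using assms(2) by (intro power_increasing) auto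
    then show ?thesis unfolding power2_eq_square by linarith
  qed
  show False
  proof (cases "b < k")
    case True
    then have "(b + 1) * (k - 1) \<le> k * k" by (intro mult_le_mono) auto
    moreover have "b \<le> k * k" using True by (metis le_square less_or_eq_imp_le order_trans)
    ultimately show False using assms(1,5) cube by linarith
  next
    case False
    then obtain d where d: "b = k + d" by (metis le_add_diff_inverse not_less)
    obtain j where j: "k = Suc j" using assms(2) by (cases k) auto
    obtain q where q: "p = Suc q" "1 \<le> q" using assms(3) by (cases p) auto
    have "b * p + 2 \<le> b + p * j" using bp assms(4) j by simp
    \<comment> \<open>Comparing \<open>b * p + 2\<close> with \<open>b + p * (k - 1)\<close> under
      \<open>b = k + d\<close> and \<open>p = q + 1\<close> cancels the terms in
      \<open>k * q\<close>. What remains bounds both \<open>d\<close> and \<open>p\<close> by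
      \<open>k\<close>.\<close>
    then have dq: "(d + 1) * q + 3 \<le> k" using d j q(1) by (simp add: algebra_simps)
    have "d + 1 \<le> (d + 1) * q" using q(2) by (cases q) auto
    then have dk: "d \<le> k" using dq by (meson add_leD1 le_trans)
    have "q \<le> (d + 1) * q" by simp
    then have "q + 3 \<le> k" using dq by (meson add_le_mono1 le_trans)
    then have pk: "p \<le> k" using q(1) by simp
    have "p * (k - 1) \<le> k * k" using pk by (intro mult_le_mono) auto
    moreover have "b \<le> k * k + k * k" using d dk le_square[of k] by linarith
    ultimately show False using assms(1,4) cube by linarith
  qed
qed

theorem theorem3p2:
  fixes G :: "('a, 'b) pre_digraph" and k :: nat
  assumes "graph G" and "k > 0"
  shows "(contains_psd_class k G \<longrightarrow>
            enat (card (verts G) - k) \<ge> th_psd_star G) \<and>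
         (arcs G \<noteq> {} \<and> \<not> contains_psd_class k G \<and>
            1 < k \<and> real k < (real (card (verts G)) / 12) powr (1 / 3) \<longrightarrow>
            th_psd_star G = k_psd G 1 \<and> k_psd G 1 > enat (card (verts G) - k))"
proof (intro conjI impI)
  show "th_psd_star G \<le> enat (card (verts G) - k)" if "contains_psd_class k G"
    using th_psd_star_le[OF assms that] .
next
  assume hyp: "arcs G \<noteq> {} \<and> \<not> contains_psd_class k G \<and>
    1 < k \<and> real k < (real (card (verts G)) / 12) powr (1 / 3)"
  let ?n = "card (verts G)"
  have "real k ^ 3 < ((real ?n / 12) powr (1 / 3)) ^ 3"
    using hyp by (intro power_strict_mono) auto
  also have "\<dots> = (real ?n / 12) powr (real 3 * (1 / 3))"
  proof (rule powr_power)
    \<comment> \<open>For zero, \<open>powr\<close> would give zero, which cannot exceed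
      \<open>real k\<close>.\<close>
    show "real ?n / 12 \<noteq> 0" using hyp by (intro notI) simp
  qed
  also have "\<dots> = real ?n / 12" by simp
  finally have "real (12 * k ^ 3) < real ?n" by simp
  then have cube: "12 * k ^ 3 < ?n" by (simp only: of_nat_less_iff)
  have "k \<le> k ^ 3" using assms(2) by (simp add: self_le_power)
  then have kn: "k \<le> ?n" using cube by linarith
  show "k_psd G 1 > enat (?n - k)" using k_psd_one_greater[OF assms _ kn] hyp by blast
  show "th_psd_star G = k_psd G 1"
  proof (rule antisym)
    show "th_psd_star G \<le> k_psd G 1"
      unfolding k_psd_def
    proof (rule Inf_greatest)
      fix x assume "x \<in> {enat (card B) | B. psd_forcing_set G B \<and> pt_psd G B = enat 1}"
      then obtain B where B: "x = enat (card B)" "psd_forcing_set G B" "pt_psd G B = enat 1" by auto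
      then have "B \<subseteq> verts G" by (auto simp: psd_forcing_set_def psd_chron_list_def)
      \<comment> \<open>The throttling number admits only proper subsets; the full vertex set is
        excluded here because its propagation time is zero.\<close>
      moreover have "B \<noteq> verts G"
      proof
        assume "B = verts G"
        then have "pt_forces G B F = 0" for F
          using pt_forces_le[of G B F 0] by (simp flip: zero_enat_def)
        then show False using B(3) pt_psd_attained[OF B(3)] by (metis enat_0_iff(2) zero_neq_one)
      qed
      moreover have "psd_product_cost G B = x" using B by (simp add: psd_product_cost_def)
      ultimately show "th_psd_star G \<le> x" unfolding th_psd_star_def by (intro Inf_lower) blast
    qed
    show "k_psd G 1 \<le> th_psd_star G"
      unfolding th_psd_star_def
    proof (rule Inf_greatest)
      fix x assume "x \<in> {psd_product_cost G B | B. B \<subset> verts G}"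
      then obtain B where B: "x = psd_product_cost G B" "B \<subset> verts G" by auto
      show "k_psd G 1 \<le> x"
      proof (cases "pt_psd G B")
        case (enat p)
        have x: "x = enat (card B * p)" using B(1) enat by (simp add: psd_product_cost_def)
        have forcing: "psd_forcing_set G B" using psd_forcing_set_of_pt[OF assms(1) enat] .
        have "1 \<le> p" using pt_psd_pos[of B G] B(2) enat by (auto simp: one_enat_def)
        \<comment> \<open>In one step the cost is \<open>card B\<close>, a value over which
          \<open>k_psd G 1\<close> is the minimum. In more steps the cost is at least
          \<open>?n - 1\<close>, which \<open>k_psd G 1\<close> does not exceed.\<close>
        then consider "p = 1" | "2 \<le> p" by linarith
        then show ?thesis
        proof cases
          case 1
          then show ?thesis unfolding k_psd_def x using forcing enat by (intro Inf_lower) auto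
        next
          case 2
          obtain F where "pt_forces G B F = enat p" using enat by (rule pt_psd_attained)
          then have "psd_upto G B F p = verts G" by (rule pt_forces_attained)
          then have "?n \<le> card B + p * (k - 1)"
            using card_psd_upto_le[OF assms, of B F p] hyp by simp
          moreover have "?n \<le> card B + (card B + 1) * (k - 1)"
            using card_verts_le_of_forcing[OF assms _ forcing] hyp by blast
          ultimately have "?n - 1 \<le> card B * p"
            using slow_cost_arith[OF cube _ 2] hyp by blast
          then have "enat (?n - 1) \<le> x" using x by simp
          then show ?thesis using k_psd_one_le[OF assms(1)] hyp order_trans by blast
        qed
      next
        case infinity
        then show ?thesis using B(1) by (simp add: psd_product_cost_def)
      qed
    qed
  qed
qed

end
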